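(* Let $p\ge 2$ be a fixed integer. Then, as $x\to\infty$, $$\sum_{i,j\le x}(i,j)^p=C_p\,x^{p+1}+O(E_p(x)),$$ where $$C_p:=\frac{2\zeta(p)-\zeta(p+1)}{(p+1)\zeta(p+1)},$$ and $E_p(x)=x^p$ for $p>2$ and $E_2(x)=x^2\log x$.
   Context: The sum is over all ordered pairs of positive integers $i,j\le x$, $(i,j)$ denotes the greatest common divisor of $i$ and $j$, and $\zeta$ is the Riemann zeta function. The implied constant may depend on $p$. *)

theory Defs
  imports Complex_Main "HOL-Library.Landau_Symbols"
begin

(* The Dirichlet series of the Riemann zeta function.  It represents zeta only
   for s > 1, where the series converges; no other values are used. *)
definition riemann_zeta :: "real \<Rightarrow> real" where
  "riemann_zeta s = (\<Sum>n. 1 / real (Suc n) powr s)"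

definition gcd_power_sum :: "nat \<Rightarrow> real \<Rightarrow> real" where
  "gcd_power_sum p x =
     (\<Sum>(i, j) \<in> {(i, j). 0 < i \<and> 0 < j \<and> real i \<le> x \<and> real j \<le> x}. real (gcd i j) ^ p)"

definition gcd_power_const :: "nat \<Rightarrow> real" where
  "gcd_power_const p =
     (2 * riemann_zeta (real p) - riemann_zeta (real (p + 1))) /
     (real (p + 1) * riemann_zeta (real (p + 1)))"

definition error_bound :: "nat \<Rightarrow> real \<Rightarrow> real" where
  "error_bound p x = (if p = 2 then x ^ 2 * ln x else x ^ p)"

end

theory Submission
  imports Defs "HOL-Number_Theory.Totient" "HOL-Analysis.Infinite_Sum" "HOL-Analysis.Harmonic_Numbers"
begin

text \<open>
  Write \<open>\<phi>\<close> for Euler's totient and \<open>P y\<close> for the sum of \<open>d ^ p\<close> over the positive integers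
  \<open>d \<le> y\<close>.  Among the pairs with \<open>j \<le> i\<close>, exactly \<open>\<phi> (i div d)\<close> have first entry \<open>i\<close> and greatest
  common divisor \<open>d\<close>, for each divisor \<open>d\<close> of \<open>i\<close>.  By symmetry the double sum is twice the sum
  over these pairs minus the diagonal, and putting \<open>i = n * d\<close> turns it into
  \<open>2 * (\<Sum>n\<le>x. \<phi> n * P (x / n)) - P x\<close> (\<open>gcd_power_sum_eq_totient_sum\<close>).

  Since \<open>P y = y ^ (p + 1) / (p + 1) + O(y ^ p)\<close> (\<open>sum_powers_approx\<close>), the main term is
  \<open>x ^ (p + 1) / (p + 1)\<close> times \<open>2 * (\<Sum>n\<le>x. \<phi> n / n ^ (p + 1)) - 1\<close>.  Completing the sum over \<open>n\<close>
  to all positive integers gives \<open>\<zeta> p / \<zeta> (p + 1)\<close>, because the identity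
  \<open>(\<Sum>d | d dvd m. \<phi> d) = m\<close> makes the product of this Dirichlet series with \<open>\<zeta> (p + 1)\<close>
  equal to \<open>\<zeta> p\<close> (\<open>has_sum_totient_dirichlet_series\<close>).

  Both errors are controlled by \<open>\<phi> n \<le> n\<close>.  The tail of the series is at most the tail of
  \<open>\<Sum>n. 1 / n\<^sup>2\<close>, that is \<open>O(1 / x)\<close>, and contributes \<open>O(x ^ p)\<close>.  The errors in \<open>P\<close> add up to at most
  \<open>x ^ p * (\<Sum>n\<le>x. 1 / n ^ (p - 1))\<close>; this last sum is bounded for \<open>p > 2\<close> and harmonic for
  \<open>p = 2\<close>, which is where the logarithm in the error term comes from.
\<close>

section \<open>Sums of powers\<close>

text \<open>The mean value theorem for the power function, in the form used to compare a sum of powers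
  with an integral.\<close>

lemma power_diff_bounds:
  fixes a b :: real
  assumes "0 \<le> a" "a \<le> b"
  shows "real (p + 1) * a ^ p * (b - a) \<le> b ^ (p + 1) - a ^ (p + 1)"
    and "b ^ (p + 1) - a ^ (p + 1) \<le> real (p + 1) * b ^ p * (b - a)"
proof -
  have "real (p + 1) * a ^ p * (b - a) \<le> b ^ (p + 1) - a ^ (p + 1) \<and>
        b ^ (p + 1) - a ^ (p + 1) \<le> real (p + 1) * b ^ p * (b - a)"
  proof (induction p)
    case 0
    then show ?case by simp
  next
    case (Suc p)
    define D where "D = b ^ (p + 1) - a ^ (p + 1)"
    have split_a: "b ^ (Suc p + 1) - a ^ (Suc p + 1) = a * D + b ^ (p + 1) * (b - a)"
      and split_b: "b ^ (Suc p + 1) - a ^ (Suc p + 1) = b * D + a ^ (p + 1) * (b - a)"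
      by (simp_all add: D_def algebra_simps)
    have mono: "a ^ (p + 1) * (b - a) \<le> b ^ (p + 1) * (b - a)"
      using assms by (intro mult_right_mono power_mono) auto
    have "a * (real (p + 1) * a ^ p * (b - a)) \<le> a * D"
      and "b * D \<le> b * (real (p + 1) * b ^ p * (b - a))"
      using Suc assms by (auto simp: D_def intro!: mult_left_mono)
    then show ?case
      using mono split_a split_b by (simp add: algebra_simps)
  qed
  then show "real (p + 1) * a ^ p * (b - a) \<le> b ^ (p + 1) - a ^ (p + 1)"
    and "b ^ (p + 1) - a ^ (p + 1) \<le> real (p + 1) * b ^ p * (b - a)"
    by blast+
qed

lemma sum_powers_bounds:
  shows "real N ^ (p + 1) \<le> real (p + 1) * (\<Sum>d=1..N. real d ^ p)"
    and "real (p + 1) * (\<Sum>d=1..N. real d ^ p) \<le> real N ^ (p + 1) + real (p + 1) * real N ^ p"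
proof -
  have "real N ^ (p + 1) \<le> real (p + 1) * (\<Sum>d=1..N. real d ^ p) \<and>
        real (p + 1) * (\<Sum>d=1..N. real d ^ p) \<le> real N ^ (p + 1) + real (p + 1) * real N ^ p"
  proof (induction N)
    case 0
    then show ?case by simp
  next
    case (Suc N)
    have "real (p + 1) * real N ^ p \<le> real (Suc N) ^ (p + 1) - real N ^ (p + 1)"
      and "real (Suc N) ^ (p + 1) - real N ^ (p + 1) \<le> real (p + 1) * real (Suc N) ^ p"
      using power_diff_bounds[of "real N" "real (Suc N)" p] by simp_all
    moreover have "real (p + 1) * (\<Sum>d=1..Suc N. real d ^ p)
        = real (p + 1) * (\<Sum>d=1..N. real d ^ p) + real (p + 1) * real (Suc N) ^ p"
      by (simp add: distrib_left del: of_nat_Suc)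
    ultimately show ?case
      using Suc by linarith
  qed
  then show "real N ^ (p + 1) \<le> real (p + 1) * (\<Sum>d=1..N. real d ^ p)"
    and "real (p + 1) * (\<Sum>d=1..N. real d ^ p) \<le> real N ^ (p + 1) + real (p + 1) * real N ^ p"
    by blast+
qed

text \<open>The bound holds uniformly for all \<open>y \<ge> 0\<close>, with constant one; it is applied below to
  every \<open>y = x / n\<close> at once.\<close>

lemma sum_powers_approx:
  fixes y :: real
  assumes "y \<ge> 0"
  shows "\<bar>(\<Sum>d=1..nat \<lfloor>y\<rfloor>. real d ^ p) - y ^ (p + 1) / real (p + 1)\<bar> \<le> y ^ p"
proof -
  define N where "N = nat \<lfloor>y\<rfloor>"
  define T where "T = (\<Sum>d=1..N. real d ^ p)"
  have N: "real N \<le> y" "y - real N \<le> 1"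
    using assms unfolding N_def by linarith+
  have "y ^ (p + 1) - real N ^ (p + 1) \<le> real (p + 1) * y ^ p * (y - real N)"
    using power_diff_bounds(2)[of "real N" y p] N by simp
  also have "\<dots> \<le> real (p + 1) * y ^ p * 1"
    using N assms by (intro mult_left_mono) auto
  finally have "y ^ (p + 1) - real (p + 1) * y ^ p \<le> real (p + 1) * T"
    using sum_powers_bounds(1)[of N p] unfolding T_def by linarith
  moreover have "real (p + 1) * T \<le> y ^ (p + 1) + real (p + 1) * y ^ p"
  proof -
    have "real N ^ (p + 1) \<le> y ^ (p + 1)" "real (p + 1) * real N ^ p \<le> real (p + 1) * y ^ p"
      using N by (auto intro!: power_mono mult_left_mono
          simp del: power_Suc power_Suc2 of_nat_Suc of_nat_add simp flip: Suc_eq_plus1)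
    then show ?thesis
      using sum_powers_bounds(2)[of p N] unfolding T_def by linarith
  qed
  ultimately have "\<bar>real (p + 1) * T - y ^ (p + 1)\<bar> \<le> real (p + 1) * y ^ p"
    by linarith
  also have "real (p + 1) * T - y ^ (p + 1) = real (p + 1) * (T - y ^ (p + 1) / real (p + 1))"
    by (simp add: field_simps)
  finally have "real (p + 1) * \<bar>T - y ^ (p + 1) / real (p + 1)\<bar> \<le> real (p + 1) * y ^ p"
    by (simp add: abs_mult)
  then show ?thesis
    unfolding T_def N_def by (simp del: of_nat_add of_nat_Suc)
qed

section \<open>From greatest common divisors to totients\<close>

lemma sum_square_symmetric:
  fixes g :: "nat \<Rightarrow> nat \<Rightarrow> real"
  assumes "\<And>i j. g i j = g j i"
  shows "(\<Sum>i=1..N. \<Sum>j=1..N. g i j) = 2 * (\<Sum>i=1..N. \<Sum>j=1..i. g i j) - (\<Sum>i=1..N. g i i)"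
proof (induction N)
  case 0
  then show ?case by simp
next
  case (Suc N)
  have "(\<Sum>i=1..N. g i (Suc N)) = (\<Sum>j=1..N. g (Suc N) j)"
    by (rule sum.cong) (auto simp: assms)
  then show ?case
    using Suc by (simp add: sum.distrib)
qed

lemma sum_gcd_eq_totient_sum:
  fixes F :: "nat \<Rightarrow> real"
  assumes "i > 0"
  shows "(\<Sum>j=1..i. F (gcd i j)) = (\<Sum>d | d dvd i. real (totient (i div d)) * F d)"
proof -
  have "(\<Sum>j=1..i. F (gcd i j)) = (\<Sum>d | d dvd i. \<Sum>j | j \<in> {1..i} \<and> gcd i j = d. F (gcd i j))"
    by (rule sum.group [symmetric]) (use assms in auto)
  also have "\<dots> = (\<Sum>d | d dvd i. real (totient (i div d)) * F d)"
  proof (rule sum.cong [OF refl])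
    fix d assume "d \<in> {d. d dvd i}"
    then have "card {k \<in> {0<..i}. gcd k i = d} = totient (i div d)"
      using assms by (intro card_gcd_eq_totient) auto
    also have "{k \<in> {0<..i}. gcd k i = d} = {j. j \<in> {1..i} \<and> gcd i j = d}"
      by (auto simp: gcd.commute)
    finally show "(\<Sum>j | j \<in> {1..i} \<and> gcd i j = d. F (gcd i j)) = real (totient (i div d)) * F d"
      by simp
  qed
  finally show ?thesis .
qed

text \<open>Both sides sum over the pairs with \<open>n * d \<le> N\<close>, grouped by the product \<open>i = n * d\<close> on
  the left.\<close>

lemma sum_divisors_eq_hyperbola_sum:
  fixes f :: "nat \<Rightarrow> nat \<Rightarrow> real"
  shows "(\<Sum>i=1..N. \<Sum>d | d dvd i. f (i div d) d) = (\<Sum>n=1..N. \<Sum>d=1..N div n. f n d)"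
proof -
  have "(\<Sum>i=1..N. \<Sum>d | d dvd i. f (i div d) d)
      = (\<Sum>(i, d) \<in> (SIGMA i:{1..N}. {d. d dvd i}). f (i div d) d)"
    by (rule sum.Sigma) auto
  also have "\<dots> = (\<Sum>(n, d) \<in> (SIGMA n:{1..N}. {1..N div n}). f n d)"
  proof (rule sum.reindex_bij_witness[where
        i = "\<lambda>(n, d). (n * d, d)" and j = "\<lambda>(i, d). (i div d, d)"], goal_cases)
    case (2 a)
    then obtain i d where a: "a = (i, d)" "1 \<le> i" "i \<le> N" "d dvd i" by auto
    then obtain n where n: "i = d * n" by (auto elim: dvdE)
    with a have pos: "d > 0" "n > 0" by auto
    have "n \<le> d * n" "d \<le> N div n"
      using a n pos by (auto simp: less_eq_div_iff_mult_less_eq)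
    moreover have "n \<le> N"
      using \<open>n \<le> d * n\<close> a n by linarith
    ultimately show ?case using a n pos by auto
  next
    case (4 b)
    then show ?case
      by (auto simp: less_eq_div_iff_mult_less_eq mult.commute)
  qed auto
  also have "\<dots> = (\<Sum>n=1..N. \<Sum>d=1..N div n. f n d)"
    by (rule sum.Sigma [symmetric]) auto
  finally show ?thesis .
qed

lemma gcd_power_sum_eq_totient_sum:
  assumes "x \<ge> 0"
  shows "gcd_power_sum p x
    = 2 * (\<Sum>n=1..nat \<lfloor>x\<rfloor>. real (totient n) * (\<Sum>d=1..nat \<lfloor>x / real n\<rfloor>. real d ^ p))
      - (\<Sum>d=1..nat \<lfloor>x\<rfloor>. real d ^ p)"
proof -
  define N where "N = nat \<lfloor>x\<rfloor>"
  have le_iff: "real i \<le> x \<longleftrightarrow> i \<le> N" for i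
    using assms unfolding N_def by (simp add: le_nat_iff le_floor_iff)
  have floor_div: "nat \<lfloor>x / real n\<rfloor> = N div n" for n
    using floor_divide_real_eq_div[of "int n" x] assms
    by (simp add: N_def nat_div_distrib)
  have "{(i, j). 0 < i \<and> 0 < j \<and> real i \<le> x \<and> real j \<le> x} = {1..N} \<times> {1..N}"
    by (auto simp: le_iff)
  then have "gcd_power_sum p x = (\<Sum>i=1..N. \<Sum>j=1..N. real (gcd i j) ^ p)"
    unfolding gcd_power_sum_def by (simp add: sum.cartesian_product)
  also have "\<dots> = 2 * (\<Sum>i=1..N. \<Sum>j=1..i. real (gcd i j) ^ p) - (\<Sum>d=1..N. real d ^ p)"
    by (subst sum_square_symmetric) (auto simp: gcd.commute)
  also have "(\<Sum>i=1..N. \<Sum>j=1..i. real (gcd i j) ^ p)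
      = (\<Sum>i=1..N. \<Sum>d | d dvd i. real (totient (i div d)) * real d ^ p)"
    by (rule sum.cong [OF refl], rule sum_gcd_eq_totient_sum) auto
  also have "\<dots> = (\<Sum>n=1..N. real (totient n) * (\<Sum>d=1..N div n. real d ^ p))"
    unfolding sum_distrib_left by (rule sum_divisors_eq_hyperbola_sum)
  finally show ?thesis
    by (simp add: floor_div N_def [symmetric])
qed

section \<open>The Dirichlet series of the totient\<close>

lemma has_sum_riemann_zeta:
  assumes "s \<ge> 2"
  shows "((\<lambda>n. 1 / real n ^ s) has_sum riemann_zeta (real s)) {0<..}"
    and "riemann_zeta (real s) > 0"
proof -
  have summable: "summable (\<lambda>n. 1 / real (Suc n) ^ s)"
    using inverse_power_summable[of s, where ?'a = real] assms
    by (subst summable_Suc_iff) (simp add: inverse_eq_divide)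
  have zeta: "riemann_zeta (real s) = (\<Sum>n. 1 / real (Suc n) ^ s)"
    unfolding riemann_zeta_def by (simp add: powr_realpow del: of_nat_Suc)
  have "((\<lambda>n. 1 / real (Suc n) ^ s) has_sum riemann_zeta (real s)) UNIV"
    using summable unfolding zeta by (intro sums_nonneg_imp_has_sum) (auto simp: summable_sums)
  moreover have "bij_betw Suc UNIV {0<..}"
    by (auto simp: bij_betw_def image_iff gr0_conv_Suc)
  ultimately show "((\<lambda>n. 1 / real n ^ s) has_sum riemann_zeta (real s)) {0<..}"
    by (subst has_sum_reindex_bij_betw [symmetric, where g = Suc and A = UNIV])
  show "riemann_zeta (real s) > 0"
    unfolding zeta by (rule suminf_pos [OF summable]) simp
qed

lemma totient_dirichlet_term_le:
  assumes "n > 0"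
  shows "real (totient n) / real n ^ (p + 1) \<le> 1 / real n ^ p"
  using assms by (simp add: divide_simps totient_le)

text \<open>Multiplying the series by \<open>\<zeta> (p + 1)\<close> gives a sum over pairs
  \<open>(n, k)\<close> of \<open>\<phi> n / (n * k) ^ (p + 1)\<close>, and grouping by \<open>m = n * k\<close> leaves
  \<open>(\<Sum>n | n dvd m. \<phi> n) / m ^ (p + 1) = 1 / m ^ p\<close>.  All terms are nonnegative, so the
  rearrangement is legitimate.\<close>

lemma has_sum_totient_dirichlet_series:
  assumes "p \<ge> 2"
  shows "((\<lambda>n. real (totient n) / real n ^ (p + 1)) has_sum
           riemann_zeta (real p) / riemann_zeta (real (p + 1))) {0<..}"
proof -
  define a where "a = (\<lambda>n. real (totient n) / real n ^ (p + 1))"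
  define b where "b = (\<lambda>k. 1 / real k ^ (p + 1))"
  define Z where "Z = riemann_zeta (real (p + 1))"
  have Z: "(b has_sum Z) {0<..}" "Z > 0"
    using has_sum_riemann_zeta[of "p + 1"] assms unfolding b_def Z_def by auto
  have "a summable_on {0<..}"
  proof (rule summable_on_comparison_test)
    show "(\<lambda>n. 1 / real n ^ p) summable_on {0<..}"
      using has_sum_riemann_zeta(1)[OF assms] by (rule has_sum_imp_summable)
  qed (use totient_dirichlet_term_le in \<open>auto simp: a_def\<close>)
  then obtain \<alpha> where \<alpha>: "(a has_sum \<alpha>) {0<..}"
    by (auto simp: summable_on_def)
  define f where "f = (\<lambda>(n, k). a n * b k)"
  have inner: "((\<lambda>k. f (n, k)) has_sum a n * Z) {0<..}" for n
    unfolding f_def by (simp add: has_sum_cmult_right Z)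
  have outer: "((\<lambda>n. a n * Z) has_sum \<alpha> * Z) {0<..}"
    by (rule has_sum_cmult_left [OF \<alpha>])
  have "f summable_on {0<..} \<times> {0<..}"
    by (rule summable_on_SigmaI [OF inner has_sum_imp_summable [OF outer]])
       (simp add: f_def a_def b_def)
  then have "(f has_sum \<alpha> * Z) ({0<..} \<times> {0<..})"
    by (rule has_sum_SigmaI [OF inner outer])
  also have "?this \<longleftrightarrow>
      ((\<lambda>(m, n). real (totient n) / real m ^ (p + 1)) has_sum \<alpha> * Z) (SIGMA m:{0<..}. {n. n dvd m})"
    by (rule has_sum_reindex_bij_witness[where
          i = "\<lambda>(m, n). (n, m div n)" and j = "\<lambda>(n, k). (n * k, n)"])
       (auto simp: f_def a_def b_def power_mult_distrib elim!: dvdE)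
  finally have "((\<lambda>m. 1 / real m ^ p) has_sum \<alpha> * Z) {0<..}"
  proof (rule has_sum_SigmaD)
    fix m :: nat assume m: "m \<in> {0<..}"
    have "(\<Sum>n | n dvd m. real (totient n) / real m ^ (p + 1))
        = real (\<Sum>n | n dvd m. totient n) / real m ^ (p + 1)"
      by (simp only: of_nat_sum sum_divide_distrib)
    also have "\<dots> = 1 / real m ^ p"
      using m by (simp add: totient_divisor_sum)
    finally show "((\<lambda>n. case (m, n) of (m, n) \<Rightarrow> real (totient n) / real m ^ (p + 1))
        has_sum 1 / real m ^ p) {n. n dvd m}"
      using m by (intro has_sum_finiteI) auto
  qed
  then have "\<alpha> * Z = riemann_zeta (real p)"
    using has_sum_riemann_zeta(1)[OF assms] by (rule has_sum_unique)
  then have "\<alpha> = riemann_zeta (real p) / Z"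
    using Z(2) by (simp add: field_simps)
  then show ?thesis
    using \<alpha> unfolding a_def Z_def by simp
qed

section \<open>Bounds for the error terms\<close>

text \<open>Telescoping, since \<open>1 / n\<^sup>2 \<le> 1 / (n - 1) - 1 / n\<close>.\<close>

lemma sum_inverse_squares_le:
  assumes "N > 0" "N \<le> M"
  shows "(\<Sum>n\<in>{N<..M}. 1 / real n ^ 2) \<le> 1 / real N - 1 / real M"
  using assms(2)
proof (induction M rule: dec_induct)
  case base
  then show ?case by simp
next
  case (step M)
  have "{N<..Suc M} = insert (Suc M) {N<..M}"
    using step by auto
  moreover have "1 / real (Suc M) ^ 2 \<le> 1 / real M - 1 / real (Suc M)"
    using step assms(1) by (simp add: divide_simps power2_eq_square)
  ultimately show ?case
    using step by simp
qed

lemma totient_dirichlet_tail_bounds: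
  assumes "p \<ge> 2" "N > 0"
    and "((\<lambda>n. real (totient n) / real n ^ (p + 1)) has_sum \<alpha>) {0<..}"
  shows "0 \<le> \<alpha> - (\<Sum>n=1..N. real (totient n) / real n ^ (p + 1))"
    and "\<alpha> - (\<Sum>n=1..N. real (totient n) / real n ^ (p + 1)) \<le> 1 / real N"
proof -
  define a where "a = (\<lambda>n. real (totient n) / real n ^ (p + 1))"
  have "(a has_sum (\<alpha> - sum a {1..N})) ({0<..} - {1..N})"
  proof (rule has_sum_Diff)
    show "(a has_sum \<alpha>) {0<..}"
      using assms(3) unfolding a_def .
  qed (auto intro: has_sum_finite)
  also have "{0<..} - {1..N} = {N<..}"
    by auto
  finally have tail: "(a has_sum (\<alpha> - sum a {1..N})) {N<..}" .
  have nonneg: "a n \<ge> 0" for n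
    by (simp add: a_def)
  have "\<alpha> - sum a {1..N} \<ge> 0"
    by (rule has_sum_nonneg [OF tail]) (simp add: nonneg)
  moreover have "\<alpha> - sum a {1..N} \<le> 1 / real N"
  proof (rule has_sum_le_finite_sums [OF tail])
    fix F assume F: "finite F" "F \<subseteq> {N<..}"
    define M where "M = Max (insert N F)"
    have M: "N \<le> M" "F \<subseteq> {N<..M}"
      using F by (auto simp: M_def)
    have "sum a F \<le> sum a {N<..M}"
      using M by (intro sum_mono2) (auto simp: nonneg)
    also have "\<dots> \<le> (\<Sum>n\<in>{N<..M}. 1 / real n ^ 2)"
    proof (rule sum_mono)
      fix n assume n: "n \<in> {N<..M}"
      have "a n \<le> 1 / real n ^ p"
        unfolding a_def using n by (intro totient_dirichlet_term_le) auto
      also have "\<dots> \<le> 1 / real n ^ 2"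
        using n assms(1) by (intro divide_left_mono power_increasing) auto
      finally show "a n \<le> 1 / real n ^ 2" .
    qed
    also have "\<dots> \<le> 1 / real N - 1 / real M"
      by (rule sum_inverse_squares_le) (use assms M in auto)
    also have "\<dots> \<le> 1 / real N"
      by simp
    finally show "sum a F \<le> 1 / real N" .
  qed
  ultimately show "0 \<le> \<alpha> - (\<Sum>n=1..N. real (totient n) / real n ^ (p + 1))"
    and "\<alpha> - (\<Sum>n=1..N. real (totient n) / real n ^ (p + 1)) \<le> 1 / real N"
    unfolding a_def by simp_all
qed

text \<open>Up to \<open>x ^ p\<close>, this sum is the total error made by replacing each \<open>P (x / n)\<close> by its main
  term.\<close>

lemma sum_totient_div_power_le:
  assumes "p \<ge> 2" "N > 0"
  shows "(\<Sum>n=1..N. real (totient n) / real n ^ p) \<le> (if p = 2 then 1 + ln (real N) else 2)"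
proof (cases "p = 2")
  case True
  have "(\<Sum>n=1..N. real (totient n) / real n ^ p) \<le> (\<Sum>n=1..N. inverse (real n))"
    by (rule sum_mono)
       (use totient_dirichlet_term_le[where p = 1] True in \<open>auto simp: inverse_eq_divide numeral_2_eq_2\<close>)
  also have "\<dots> = harm N"
    by (simp add: harm_def)
  also have "\<dots> \<le> 1 + ln (real N)"
    using euler_mascheroni_sequence_decreasing[of 1 N] assms by (simp add: harm_def)
  finally show ?thesis
    using True by simp
next
  case False
  have "(\<Sum>n=1..N. real (totient n) / real n ^ p) \<le> (\<Sum>n=1..N. 1 / real n ^ 2)"
  proof (rule sum_mono)
    fix n assume n: "n \<in> {1..N}"
    have "real (totient n) / real n ^ p \<le> 1 / real n ^ (p - 1)"
      using totient_dirichlet_term_le[of n "p - 1"] n assms by simp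
    also have "\<dots> \<le> 1 / real n ^ 2"
      using n assms False by (intro divide_left_mono power_increasing) auto
    finally show "real (totient n) / real n ^ p \<le> 1 / real n ^ 2" .
  qed
  also have "\<dots> = 1 + (\<Sum>n\<in>{1<..N}. 1 / real n ^ 2)"
  proof -
    have "{1..N} = insert 1 {1<..N}"
      using assms by auto
    then show ?thesis
      by simp
  qed
  also have "\<dots> \<le> 1 + (1 / real 1 - 1 / real N)"
    using assms by (intro add_left_mono sum_inverse_squares_le) auto
  also have "\<dots> \<le> 2"
    by simp
  finally show ?thesis
    using False by simp
qed

section \<open>The asymptotic formula\<close>

text \<open>In the constant \<open>5\<close>, the diagonal accounts for \<open>1\<close> and the tail of the Dirichlet series for
  \<open>4 = 2 * 2\<close>, since \<open>x / N \<le> 2\<close> for the integer part \<open>N\<close> of \<open>x\<close>.\<close>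

lemma gcd_power_sum_approx:
  assumes "p \<ge> 2" "x \<ge> 1"
  shows "\<bar>gcd_power_sum p x - gcd_power_const p * x ^ (p + 1)\<bar>
           \<le> x ^ p * (2 * (if p = 2 then 1 + ln x else 2) + 5)"
proof -
  define N where "N = nat \<lfloor>x\<rfloor>"
  define H where "H = (if p = 2 then 1 + ln x else 2)"
  define \<alpha> where "\<alpha> = riemann_zeta (real p) / riemann_zeta (real (p + 1))"
  define A where "A = (\<Sum>n=1..N. real (totient n) / real n ^ (p + 1))"
  define P where "P = (\<lambda>y::real. \<Sum>d=1..nat \<lfloor>y\<rfloor>. real d ^ p)"
  define R where "R = (\<lambda>y. P y - y ^ (p + 1) / real (p + 1))"
  define c where "c = x ^ (p + 1) / real (p + 1)"
  have N: "N > 0" "real N \<le> x"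
    using assms unfolding N_def by linarith+
  have "x < real N + 1"
    using assms unfolding N_def by linarith
  then have double: "x \<le> 2 * real N"
    using N(1) by linarith
  have R: "\<bar>R y\<bar> \<le> y ^ p" if "y \<ge> 0" for y
    unfolding R_def P_def by (rule sum_powers_approx [OF that])
  have const: "gcd_power_const p * x ^ (p + 1) = (2 * \<alpha> - 1) * c"
    using has_sum_riemann_zeta(2)[of "p + 1"] assms
    unfolding gcd_power_const_def \<alpha>_def c_def
    by (simp add: divide_simps del: of_nat_add of_nat_Suc power_Suc)
  have "gcd_power_sum p x = 2 * (\<Sum>n=1..N. real (totient n) * P (x / real n)) - P x"
    using gcd_power_sum_eq_totient_sum[of x p] assms unfolding N_def P_def by simp
  also have "(\<Sum>n=1..N. real (totient n) * P (x / real n))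
      = (\<Sum>n=1..N. real (totient n) * R (x / real n) + c * (real (totient n) / real n ^ (p + 1)))"
    by (rule sum.cong) (simp_all add: R_def c_def power_divide algebra_simps)
  also have "\<dots> = (\<Sum>n=1..N. real (totient n) * R (x / real n)) + c * A"
    by (simp only: sum.distrib A_def sum_distrib_left)
  also have "P x = R x + c"
    by (simp add: R_def c_def)
  finally have decomposition: "gcd_power_sum p x - gcd_power_const p * x ^ (p + 1)
      = 2 * (\<Sum>n=1..N. real (totient n) * R (x / real n)) - R x - 2 * (c * (\<alpha> - A))"
    unfolding const by (simp add: algebra_simps)
  have "\<bar>\<Sum>n=1..N. real (totient n) * R (x / real n)\<bar>
      \<le> (\<Sum>n=1..N. x ^ p * (real (totient n) / real n ^ p))"
  proof (rule order_trans [OF sum_abs], rule sum_mono)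
    fix n
    have "real (totient n) * \<bar>R (x / real n)\<bar> \<le> real (totient n) * (x / real n) ^ p"
      using assms by (intro mult_left_mono R) auto
    then show "\<bar>real (totient n) * R (x / real n)\<bar> \<le> x ^ p * (real (totient n) / real n ^ p)"
      by (simp add: abs_mult power_divide mult.commute)
  qed
  also have "\<dots> = x ^ p * (\<Sum>n=1..N. real (totient n) / real n ^ p)"
    by (simp only: sum_distrib_left)
  also have "\<dots> \<le> x ^ p * H"
  proof (rule mult_left_mono)
    have "(if p = 2 then 1 + ln (real N) else 2) \<le> H"
      using N unfolding H_def by simp
    then show "(\<Sum>n=1..N. real (totient n) / real n ^ p) \<le> H"
      using sum_totient_div_power_le[OF assms(1) N(1)] by linarith
  qed (use assms in auto)
  finally have powers: "\<bar>\<Sum>n=1..N. real (totient n) * R (x / real n)\<bar> \<le> x ^ p * H" .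
  have diagonal: "\<bar>R x\<bar> \<le> x ^ p"
    using assms by (intro R) auto
  have "0 \<le> \<alpha> - A" "\<alpha> - A \<le> 1 / real N"
    using totient_dirichlet_tail_bounds[OF assms(1) N(1) has_sum_totient_dirichlet_series [OF assms(1)]]
    unfolding A_def \<alpha>_def by auto
  moreover have "0 \<le> c" "c \<le> x ^ (p + 1)"
    using assms by (auto simp: c_def divide_simps mult_le_cancel_left1 not_less)
  ultimately have "0 \<le> c * (\<alpha> - A)" "c * (\<alpha> - A) \<le> x ^ (p + 1) * (1 / real N)"
    using assms by (simp, intro mult_mono) auto
  moreover have "x ^ (p + 1) * (1 / real N) \<le> 2 * x ^ p"
    using N mult_left_mono[OF double, of "x ^ p"] assms by (simp add: divide_simps mult_ac)
  ultimately have "\<bar>gcd_power_sum p x - gcd_power_const p * x ^ (p + 1)\<bar> \<le> 2 * (x ^ p * H) + 5 * x ^ p"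
    using powers diagonal unfolding decomposition by linarith
  also have "\<dots> = x ^ p * (2 * H + 5)"
    by (simp add: algebra_simps)
  finally show ?thesis
    unfolding H_def .
qed

theorem theorem6p1:
  fixes p :: nat
  assumes "p \<ge> 2"
  shows "(\<lambda>x::real. gcd_power_sum p x - gcd_power_const p * x ^ (p + 1))
           \<in> O[at_top](error_bound p)"
proof (rule bigoI[where c = 9])
  \<comment> \<open>For \<open>x \<ge> exp 1\<close> the logarithm is at least one and absorbs the constants.\<close>
  show "eventually (\<lambda>x. norm (gcd_power_sum p x - gcd_power_const p * x ^ (p + 1))
      \<le> 9 * norm (error_bound p x)) at_top"
    using eventually_ge_at_top[of "exp 1"]
  proof eventually_elim
    case (elim x)
    have x: "x \<ge> 1"
      using elim one_le_exp_iff[of "1::real"] by linarith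
    have ln: "ln x \<ge> 1"
      using elim x by (simp add: ln_ge_iff)
    have "x ^ p * (2 * (if p = 2 then 1 + ln x else 2) + 5) \<le> x ^ p * (9 * (if p = 2 then ln x else 1))"
      using ln x by (intro mult_left_mono) auto
    also have "\<dots> = 9 * norm (error_bound p x)"
      using ln x by (auto simp: error_bound_def)
    finally show ?case
      using gcd_power_sum_approx[OF assms x] by simp
  qed
qed

end
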